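(* Let $\|\cdot\|$ be a norm on $\mathbb{R}^d$ (the source norm), with associated Capra coupling $c$, and with associated families $\{\|\cdot\|^{\mathcal{R}}_{(K)}\}_{K\subset V}$ of local-coordinate-$K$ norms and $\{\|\cdot\|^{\mathcal{R}}_{(K),\star}\}_{K\subset V}$ of dual local-coordinate-$K$ norms. Let $F:2^V\to\overline{\mathbb{R}}$ be a set function and $x\in\mathbb{R}^d$. - The Capra-subdifferential of $F\circ\mathrm{supp}$ at $0$ is $$\partial_c(F\circ\mathrm{supp})(0)=\bigcap_{K\subset V}\big[F(K)\,\dot{+}_{\mathrm{upp}}\,(-F(\emptyset))\big]\,\mathbb{B}^{\mathcal{R}}_{(K),\star},$$ where, for $\lambda\in\overline{\mathbb{R}}$, $\lambda\,\mathbb{B}^{\mathcal{R}}_{(K),\star}$ denotes $\{y\in\mathbb{R}^d:\|y_K\|^{\mathcal{R}}_{(K),\star}\le\lambda\}$ (so that it is $\emptyset$ for $\lambda\in[-\infty,0)$ and $\mathbb{R}^d$ for $\lambda=+\infty$). - If $x\neq0$, let $L=\mathrm{supp}(x)\ne\emptyset$. The Capra-subdifferential of $F\circ\mathrm{supp}$ at $x$ is given as follows: (a) if either $F(L)=-\infty$ or $F\equiv+\infty$, then $\partial_c(F\circ\mathrm{supp})(x)=\mathbb{R}^d$; (b) if $F(L)=+\infty$ and there exists $K\subset V$ such that $F(K)\ne+\infty$, then $\partial_c(F\circ\mathrm{supp})(x)=\emptyset$; (c) if $-\infty<F(L)<+\infty$, then $$y\in\partial_c(F\circ\mathrm{supp})(x)\iff\begin{cases}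 y\in N_{\mathbb{B}^{\mathcal{R}}_{(L)}}\!\Big(\dfrac{x}{\|x\|^{\mathcal{R}}_{(L)}}\Big)\ \text{ and}\\[2mm] L\in\operatorname*{arg\,max}_{K\subset V}\big[\|y_K\|^{\mathcal{R}}_{(K),\star}-F(K)\big].\end{cases}$$
   Context: $d\ge 1$ is an integer, $V=\{1,\ldots,d\}$, $\langle\cdot,\cdot\rangle$ is the standard scalar product on $\mathbb{R}^d$, $\overline{\mathbb{R}}=[-\infty,+\infty]$. The support mapping is $\mathrm{supp}(x)=\{j\in V: x_j\neq 0\}$. For $K\subset V$, $\mathcal{R}_K=\{x\in\mathbb{R}^d: x_j=0\ \forall j\notin K\}$, and $y_K$ is the orthogonal projection of $y\in\mathbb{R}^d$ on $\mathcal{R}_K$. For $J\subset V$, $\|y\|_{J,\star}=\sup\{\langle x,y\rangle: x\in\mathcal{R}_J,\ \|x\|\le1\}$ for $y\in\mathcal{R}_J$. The dual local-coordinate-$K$ norm is the norm on $\mathcal{R}_K$ given by $\|y\|^{\mathcal{R}}_{(K),\star}=\sup_{J\subset K}\|y_J\|_{J,\star}$, with the convention $\|\cdot\|^{\mathcal{R}}_{(\emptyset),\star}=0$; it is extended to a seminorm on $\mathbb{R}^d$ by $y\mapsto\|y_K\|^{\mathcal{R}}_{(K),\star}$. The local-coordinate-$K$ norm $\|\cdot\|^{\mathcal{R}}_{(K)}$ is the norm on $\mathcal{R}_K$ whose dual norm on $\mathcal{R}_K$ is $\|\cdot\|^{\mathcal{R}}_{(K),\star}$, i.e. $\|x\|^{\mathcal{R}}_{(K)}=\sup\{\langle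 x,y\rangle: y\in\mathcal{R}_K,\ \|y\|^{\mathcal{R}}_{(K),\star}\le1\}$; its unit ball is $\mathbb{B}^{\mathcal{R}}_{(K)}=\{x\in\mathcal{R}_K:\|x\|^{\mathcal{R}}_{(K)}\le1\}$. The normal cone to a nonempty closed convex $C\subset\mathbb{R}^d$ at $x\in C$ is $N_C(x)=\{y\in\mathbb{R}^d:\langle x'-x,y\rangle\le0\ \forall x'\in C\}$. The lower and upper additions $\dot{+}_{\mathrm{low}},\dot{+}_{\mathrm{upp}}$ extend $+$ to $\overline{\mathbb{R}}$, with $(+\infty)+(-\infty)$ (in either order) equal to $-\infty$ and $+\infty$ respectively. The Capra coupling is $c(x,y)=\langle x,y\rangle/\|x\|$ if $x\ne 0$, and $c(0,y)=0$. The $c$-conjugate of $f:\mathbb{R}^d\to\overline{\mathbb{R}}$ is $f^c(y)=\sup_{x\in\mathbb{R}^d}\big(c(x,y)\dot{+}_{\mathrm{low}}(-f(x))\big)$, and the Capra-subdifferential of $f$ at $x$ is $\partial_cf(x)=\{y\in\mathbb{R}^d: f^c(y)=c(x,y)\dot{+}_{\mathrm{low}}(-f(x))\}$. *)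

theory Defs
  imports "HOL-Analysis.Analysis"
begin

definition is_norm :: "(real^'n \<Rightarrow> real) \<Rightarrow> bool" where
  "is_norm N \<longleftrightarrow>
     (\<forall>x. 0 \<le> N x) \<and> (\<forall>x. N x = 0 \<longleftrightarrow> x = 0) \<and>
     (\<forall>a x. N (a *\<^sub>R x) = \<bar>a\<bar> * N x) \<and>
     (\<forall>x y. N (x + y) \<le> N x + N y)"

definition supp :: "real^'n \<Rightarrow> 'n set" where
  "supp x = {j. x $ j \<noteq> 0}"

definition coord_space :: "'n set \<Rightarrow> (real^'n) set" where
  "coord_space K = {x. \<forall>j. j \<notin> K \<longrightarrow> x $ j = 0}"

definition coord_proj :: "'n set \<Rightarrow> real^'n \<Rightarrow> real^'n" where
  "coord_proj K y = (\<chi> j. if j \<in> K then y $ j else 0)"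

lemma coord_proj_orthogonal_projection:
  fixes y z :: "real^'n"
  shows "z = coord_proj K y \<longleftrightarrow>
    z \<in> coord_space K \<and> (\<forall>w \<in> coord_space K. (y - z) \<bullet> w = 0)"
proof
  assume "z = coord_proj K y"
  then show "z \<in> coord_space K \<and> (\<forall>w \<in> coord_space K. (y - z) \<bullet> w = 0)"
    by (auto simp: coord_proj_def coord_space_def inner_vec_def intro!: sum.neutral)
next
  assume A: "z \<in> coord_space K \<and> (\<forall>w \<in> coord_space K. (y - z) \<bullet> w = 0)"
  show "z = coord_proj K y"
  proof (simp add: vec_eq_iff coord_proj_def, intro allI conjI impI)
    fix j assume "j \<in> K"
    then have "axis j 1 \<in> coord_space K"
      by (auto simp: coord_space_def axis_def)
    with A have "(y - z) \<bullet> axis j 1 = 0" by blast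
    then show "z $ j = y $ j" by (simp add: inner_axis)
  next
    fix j assume "j \<notin> K"
    with A show "z $ j = 0" by (simp add: coord_space_def)
  qed
qed

(* When N is a norm, the suprema in the next three definitions are over nonempty
   sets that are bounded above (for y, resp. x, in the stated subspace), so the
   conditionally complete supremum on the reals is the intended one. *)

(* Dual norm on coord_space J; meant for y in coord_space J. *)
definition dual_norm_on :: "(real^'n \<Rightarrow> real) \<Rightarrow> 'n set \<Rightarrow> real^'n \<Rightarrow> real" where
  "dual_norm_on N J y = (SUP x \<in> {x \<in> coord_space J. N x \<le> 1}. x \<bullet> y)"

(* Dual local-coordinate-K norm on coord_space K; the seminorm extending it to the
   whole space is y |-> dual_local_norm N K (coord_proj K y). For K = {} the value
   is 0, by the lemma below. *)
definition dual_local_norm :: "(real^'n \<Rightarrow> real) \<Rightarrow> 'n set \<Rightarrow> real^'n \<Rightarrow> real" where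
  "dual_local_norm N K y = (SUP J \<in> Pow K. dual_norm_on N J (coord_proj J y))"

lemma dual_local_norm_empty:
  fixes N :: "real^'n \<Rightarrow> real" and y :: "real^'n"
  assumes "is_norm N"
  shows "dual_local_norm N {} y = 0"
proof -
  have N0: "N 0 = 0" using assms unfolding is_norm_def by blast
  have "{x \<in> coord_space {}. N x \<le> 1} = {0}"
  proof (intro equalityI subsetI)
    fix x assume "x \<in> {x \<in> coord_space {}. N x \<le> 1}"
    then have "x = 0" by (simp add: coord_space_def vec_eq_iff)
    then show "x \<in> {0}" by simp
  next
    fix x :: "real^'n" assume "x \<in> {0}"
    then show "x \<in> {x \<in> coord_space {}. N x \<le> 1}"
      by (simp add: coord_space_def N0)
  qed
  then show ?thesis by (simp add: dual_local_norm_def dual_norm_on_def)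
qed

definition local_norm :: "(real^'n \<Rightarrow> real) \<Rightarrow> 'n set \<Rightarrow> real^'n \<Rightarrow> real" where
  "local_norm N K x = (SUP y \<in> {y \<in> coord_space K. dual_local_norm N K y \<le> 1}. x \<bullet> y)"

definition local_ball :: "(real^'n \<Rightarrow> real) \<Rightarrow> 'n set \<Rightarrow> (real^'n) set" where
  "local_ball N K = {x \<in> coord_space K. local_norm N K x \<le> 1}"

definition scaled_dual_local_ball ::
    "(real^'n \<Rightarrow> real) \<Rightarrow> 'n set \<Rightarrow> ereal \<Rightarrow> (real^'n) set" where
  "scaled_dual_local_ball N K r = {y. ereal (dual_local_norm N K (coord_proj K y)) \<le> r}"

definition normal_cone :: "(real^'n) set \<Rightarrow> real^'n \<Rightarrow> (real^'n) set" where
  "normal_cone C x = {y. \<forall>x' \<in> C. (x' - x) \<bullet> y \<le> 0}"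

(* The two additions differ only on opposite infinities. *)

definition low_add :: "ereal \<Rightarrow> ereal \<Rightarrow> ereal"  (infixl "+\<^sub>l" 65) where
  "a +\<^sub>l b = (if a = -\<infinity> \<or> b = -\<infinity> then -\<infinity> else a + b)"

definition upp_add :: "ereal \<Rightarrow> ereal \<Rightarrow> ereal"  (infixl "+\<^sub>u" 65) where
  "a +\<^sub>u b = (if a = \<infinity> \<or> b = \<infinity> then \<infinity> else a + b)"

definition capra :: "(real^'n \<Rightarrow> real) \<Rightarrow> real^'n \<Rightarrow> real^'n \<Rightarrow> real" where
  "capra N x y = (if x = 0 then 0 else (x \<bullet> y) / N x)"

definition conjugate ::
    "(real^'n \<Rightarrow> real^'n \<Rightarrow> real) \<Rightarrow> (real^'n \<Rightarrow> ereal) \<Rightarrow> real^'n \<Rightarrow> ereal" where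
  "conjugate c f y = (SUP x. ereal (c x y) +\<^sub>l (- f x))"

definition subdifferential ::
    "(real^'n \<Rightarrow> real^'n \<Rightarrow> real) \<Rightarrow> (real^'n \<Rightarrow> ereal) \<Rightarrow> real^'n \<Rightarrow> (real^'n) set" where
  "subdifferential c f x = {y. conjugate c f y = ereal (c x y) +\<^sub>l (- f x)}"

end

theory Submission
  imports Defs
begin

text \<open>
  The value of \<^term>\<open>F \<circ> supp\<close> is constant on each set of vectors with a given support
  \<open>K\<close>. Hence the inequality that characterises a Capra-subgradient splits into one
  inequality per \<open>K\<close>, in which only the supremum over \<^prop>\<open>supp x' = K\<close> of the coupling
  \<open>\<langle>x', y\<rangle> / N x'\<close> matters. That supremum is the dual norm \<open>D K y\<close> of the restriction
  of \<open>N\<close> to \<^term>\<open>coord_space K\<close>, because the vectors whose support is exactly \<open>K\<close> are dense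
  in this subspace (\<open>all_capra_le_iff\<close>). So \<open>y\<close> is a subgradient at \<open>x\<close> iff
  \<open>D K y\<close> is at most \<open>capra N x y\<close> plus \<open>F K - F (supp x)\<close>, for all \<open>K\<close>
  (\<open>in_subdifferential_supp_iff\<close>), with the upper addition settling the infinite values.

  The dual local-coordinate norm is this same \<open>D K\<close>: dual norms on coordinate subspaces
  grow with the subspace, so the supremum over \<open>J \<subseteq> K\<close> is reached at \<open>J = K\<close>
  (\<open>dual_local_norm_eq\<close>). This gives the formula at 0 and the two cases with infinite values
  directly.

  When \<open>L = supp x\<close> and \<open>F L\<close> is finite, the inequality for \<open>K = L\<close> reads
  \<open>D L y \<le> capra N x y\<close>. The opposite inequality always holds, so it is an equality, and
  then the remaining inequalities say that \<open>L\<close> maximises \<open>D K y - F K\<close>. The equality is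
  membership in the normal cone, since by bipolarity the local-coordinate norm is \<open>N\<close>
  itself on \<^term>\<open>coord_space L\<close> (\<open>local_norm_eq\<close>).
\<close>

section \<open>Norms and coordinate subspaces\<close>

lemma is_norm_nonneg: "is_norm N \<Longrightarrow> 0 \<le> N x"
  and is_norm_eq_0: "is_norm N \<Longrightarrow> N x = 0 \<longleftrightarrow> x = 0"
  and is_norm_scale: "is_norm N \<Longrightarrow> N (a *\<^sub>R x) = \<bar>a\<bar> * N x"
  and is_norm_triangle: "is_norm N \<Longrightarrow> N (x + y) \<le> N x + N y"
  unfolding is_norm_def by auto

lemma is_norm_zero: "is_norm N \<Longrightarrow> N 0 = 0"
  by (simp add: is_norm_eq_0)

lemma is_norm_pos: "is_norm N \<Longrightarrow> x \<noteq> 0 \<Longrightarrow> 0 < N x"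
  using is_norm_nonneg[of N x] is_norm_eq_0[of N x] by linarith

lemma is_norm_minus: "is_norm N \<Longrightarrow> N (- x) = N x"
  using is_norm_scale[of N "-1" x] by simp

lemma continuous_on_is_norm:
  fixes N :: "real^'n \<Rightarrow> real"
  assumes "is_norm N"
  shows "continuous_on UNIV N"
proof (rule convex_on_continuous)
  show "convex_on UNIV N"
  proof (rule convex_onI)
    fix t :: real and x y :: "real^'n"
    assume "0 < t" "t < 1"
    then show "N ((1 - t) *\<^sub>R x + t *\<^sub>R y) \<le> (1 - t) * N x + t * N y"
      using is_norm_triangle[OF assms, of "(1 - t) *\<^sub>R x" "t *\<^sub>R y"]
      by (simp add: is_norm_scale[OF assms])
  qed simp
qed simp

text \<open>
  Equivalence with the Euclidean norm, in the direction that makes unit balls bounded: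
  \<open>c\<close> is the minimum of \<open>N\<close> on the compact Euclidean unit sphere.
\<close>

lemma is_norm_lower_bound:
  fixes N :: "real^'n \<Rightarrow> real"
  assumes "is_norm N"
  obtains c where "c > 0" "\<And>x. c * norm x \<le> N x"
proof -
  have "\<exists>x\<in>sphere 0 1. \<forall>y\<in>sphere (0::real^'n) 1. N x \<le> N y"
    by (rule continuous_attains_inf)
      (use continuous_on_is_norm[OF assms] in \<open>auto intro: continuous_on_subset\<close>)
  then obtain u :: "real^'n" where u: "norm u = 1" "\<And>y. norm y = 1 \<Longrightarrow> N u \<le> N y"
    by auto
  have "N u * norm x \<le> N x" for x
  proof (cases "x = 0")
    case False
    then have "N u \<le> N (x /\<^sub>R norm x)" by (intro u(2)) simp
    then show ?thesis using False by (simp add: is_norm_scale[OF assms] field_simps)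
  qed (simp add: is_norm_nonneg[OF assms])
  moreover have "N u > 0" using u(1) by (intro is_norm_pos[OF assms]) auto
  ultimately show ?thesis using that by blast
qed

lemma coord_space_zero [simp]: "0 \<in> coord_space K"
  by (simp add: coord_space_def)

lemma coord_space_scale: "x \<in> coord_space K \<Longrightarrow> a *\<^sub>R x \<in> coord_space K"
  by (simp add: coord_space_def)

lemma coord_space_mono: "J \<subseteq> K \<Longrightarrow> coord_space J \<subseteq> coord_space K"
  by (auto simp: coord_space_def)

lemma coord_proj_in_coord_space: "coord_proj K y \<in> coord_space K"
  by (simp add: coord_space_def coord_proj_def)

lemma inner_coord_proj: "x \<in> coord_space K \<Longrightarrow> x \<bullet> coord_proj K y = x \<bullet> y"
  unfolding inner_vec_def by (rule sum.cong) (auto simp: coord_space_def coord_proj_def)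

lemma supp_subset_coord_space: "x \<in> coord_space (supp x)"
  by (simp add: coord_space_def supp_def)

lemma supp_eq_empty_iff: "supp x = {} \<longleftrightarrow> x = 0"
  by (auto simp: supp_def vec_eq_iff)

lemma ex_supp: "\<exists>x::real^'n. supp x = K"
  by (rule exI[of _ "\<chi> j. if j \<in> K then 1 else 0"]) (auto simp: supp_def)

section \<open>Dual norms on coordinate subspaces\<close>

lemma bdd_above_inner_unit_ball:
  fixes N :: "real^'n \<Rightarrow> real"
  assumes "is_norm N"
  shows "bdd_above ((\<lambda>x. x \<bullet> y) ` {x \<in> coord_space K. N x \<le> 1})"
proof -
  obtain c where c: "c > 0" "\<And>x. c * norm x \<le> N x"
    using is_norm_lower_bound[OF assms] by blast
  have "x \<bullet> y \<le> (1 / c) * norm y" if "N x \<le> 1" for x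
  proof -
    have "norm x \<le> 1 / c"
      using c(2)[of x] that c(1) by (simp add: field_simps)
    then have "norm x * norm y \<le> (1 / c) * norm y"
      by (rule mult_right_mono) simp
    then show ?thesis using norm_cauchy_schwarz[of x y] by linarith
  qed
  then show ?thesis by (intro bdd_aboveI2[where M = "(1 / c) * norm y"]) auto
qed

lemma dual_norm_on_le_iff:
  assumes "is_norm N"
  shows "dual_norm_on N K y \<le> m \<longleftrightarrow> (\<forall>x \<in> coord_space K. N x \<le> 1 \<longrightarrow> x \<bullet> y \<le> m)"
proof -
  have "{x \<in> coord_space K. N x \<le> 1} \<noteq> {}"
    using is_norm_zero[OF assms] by (auto intro!: exI[of _ 0])
  then show ?thesis
    unfolding dual_norm_on_def
    by (subst cSUP_le_iff[OF _ bdd_above_inner_unit_ball[OF assms]]) auto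
qed

lemma dual_norm_on_nonneg:
  assumes "is_norm N"
  shows "0 \<le> dual_norm_on N K y"
  using dual_norm_on_le_iff[OF assms, of K y "dual_norm_on N K y"]
    coord_space_zero[of K] is_norm_zero[OF assms] by fastforce

lemma inner_le_dual_norm_on:
  assumes "is_norm N" "x \<in> coord_space K"
  shows "x \<bullet> y \<le> dual_norm_on N K y * N x"
proof (cases "x = 0")
  case False
  have "N (x /\<^sub>R N x) \<le> 1"
    using is_norm_pos[OF assms(1) False] by (simp add: is_norm_scale[OF assms(1)])
  then have "(x /\<^sub>R N x) \<bullet> y \<le> dual_norm_on N K y"
    using dual_norm_on_le_iff[OF assms(1), of K y "dual_norm_on N K y"]
      coord_space_scale[OF assms(2)] by blast
  then show ?thesis using is_norm_pos[OF assms(1) False] by (simp add: field_simps)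
qed (simp add: is_norm_zero[OF assms(1)])

lemma dual_norm_on_coord_proj:
  "J \<subseteq> K \<Longrightarrow> dual_norm_on N J (coord_proj K y) = dual_norm_on N J y"
  unfolding dual_norm_on_def
  by (rule SUP_cong) (auto intro!: inner_coord_proj dest: coord_space_mono)

lemma dual_norm_on_mono:
  assumes "is_norm N" "J \<subseteq> K"
  shows "dual_norm_on N J y \<le> dual_norm_on N K y"
proof -
  show ?thesis
    using coord_space_mono[OF assms(2)] dual_norm_on_le_iff[OF assms(1), of K y "dual_norm_on N K y"]
    by (auto simp: dual_norm_on_le_iff[OF assms(1)])
qed

text \<open>
  Any linear form bounded on the unit ball of \<^term>\<open>coord_space K\<close> is bounded by the same
  constant on that of a smaller coordinate subspace, so \<open>J = K\<close> realises the supremum.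
  No projection of \<open>y\<close> is left on the right-hand side, as a vector of \<^term>\<open>coord_space K\<close>
  has the same inner product with \<open>y\<close> as with its projection.
\<close>

lemma dual_local_norm_eq:
  assumes "is_norm N"
  shows "dual_local_norm N K y = dual_norm_on N K y"
  unfolding dual_local_norm_def
proof (rule cSup_eq_maximum)
  show "dual_norm_on N K y \<in> (\<lambda>J. dual_norm_on N J (coord_proj J y)) ` Pow K"
    by (rule image_eqI[of _ _ K]) (simp_all add: dual_norm_on_coord_proj)
qed (auto simp: dual_norm_on_coord_proj intro: dual_norm_on_mono[OF assms])

text \<open>
  A norm on a finite-dimensional space is its own bidual. The nontrivial inequality uses
  convex separation: for \<open>0 < r < N x\<close> the point \<open>x / r\<close> lies outside the closed unit ball of
  \<^term>\<open>coord_space K\<close>, and a normalised separating linear form, projected on the subspace,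
  belongs to the dual ball and takes a value above \<open>r\<close> at \<open>x\<close>.
\<close>

lemma local_norm_eq:
  fixes N :: "real^'n \<Rightarrow> real"
  assumes "is_norm N" "x \<in> coord_space K"
  shows "local_norm N K x = N x"
proof -
  let ?Y = "{y \<in> coord_space K. dual_norm_on N K y \<le> 1}"
  have upper: "x \<bullet> y \<le> N x" if "y \<in> ?Y" for y
  proof -
    have "dual_norm_on N K y * N x \<le> 1 * N x"
      using that by (intro mult_right_mono) (auto simp: is_norm_nonneg[OF assms(1)])
    then show ?thesis using inner_le_dual_norm_on[OF assms, of y] by linarith
  qed
  have "0 \<in> ?Y" by (simp add: dual_norm_on_le_iff[OF assms(1)])
  have lower: "\<exists>y \<in> ?Y. r < x \<bullet> y" if r: "0 < r" "r < N x" for r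
  proof -
    let ?C = "{z \<in> coord_space K. N z \<le> 1}"
    have "closed ?C"
    proof -
      have "closed {z. N z \<le> 1}"
        using continuous_on_is_norm[OF assms(1)] by (intro closed_Collect_le) auto
      moreover have "closed (coord_space K)"
        unfolding coord_space_def
        by (intro closed_Collect_all closed_Collect_imp closed_Collect_eq open_Collect_const) (auto intro!: continuous_intros)
      moreover have "?C = {z. N z \<le> 1} \<inter> coord_space K" by auto
      ultimately show ?thesis by auto
    qed
    moreover have "convex ?C"
    proof (rule convexI)
      fix u v and s t :: real
      assume uv: "u \<in> ?C" "v \<in> ?C" and st: "0 \<le> s" "0 \<le> t" "s + t = 1"
      have "N (s *\<^sub>R u + t *\<^sub>R v) \<le> s * N u + t * N v"
        using is_norm_triangle[OF assms(1), of "s *\<^sub>R u" "t *\<^sub>R v"] st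
        by (simp add: is_norm_scale[OF assms(1)])
      also have "\<dots> \<le> s * 1 + t * 1"
        using uv st by (intro add_mono mult_left_mono) auto
      finally show "s *\<^sub>R u + t *\<^sub>R v \<in> ?C"
        using uv st by (auto simp: coord_space_def)
    qed
    moreover have "x /\<^sub>R r \<notin> ?C"
      using r by (simp add: is_norm_scale[OF assms(1)] field_simps)
    ultimately obtain a b where ab: "a \<bullet> (x /\<^sub>R r) < b" "\<And>z. z \<in> ?C \<Longrightarrow> b < a \<bullet> z"
      using separating_hyperplane_closed_point[of ?C "x /\<^sub>R r"] by blast
    have "b < 0" using ab(2)[of 0] is_norm_zero[OF assms(1)] by simp
    \<comment> \<open>On the ball \<open>\<langle>a, z\<rangle> > b\<close>, and \<open>\<langle>a, x / r\<rangle> < b\<close>, so dividing by the negative \<open>b\<close>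
      turns the separation into \<open>\<langle>z, y\<rangle> \<le> 1\<close> on the ball and \<open>\<langle>x / r, y\<rangle> > 1\<close>.\<close>
    define y where "y = coord_proj K (a /\<^sub>R b)"
    have inner_y: "z \<bullet> y = (a \<bullet> z) / b" if "z \<in> coord_space K" for z
      using inner_coord_proj[OF that] by (simp add: y_def inner_commute divide_inverse_commute)
    have "y \<in> ?Y"
    proof -
      have "z \<bullet> y \<le> 1" if "z \<in> coord_space K" "N z \<le> 1" for z
        using ab(2)[of z] that \<open>b < 0\<close> by (simp add: inner_y field_simps)
      then show ?thesis
        by (simp add: dual_norm_on_le_iff[OF assms(1)] y_def coord_proj_in_coord_space)
    qed
    moreover have "r < x \<bullet> y"
      using ab(1) r \<open>b < 0\<close> by (simp add: inner_y[OF assms(2)] field_simps)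
    ultimately show ?thesis by blast
  qed
  have bdd: "bdd_above ((\<lambda>y. x \<bullet> y) ` ?Y)" using upper by (intro bdd_aboveI2) auto
  have "(SUP y \<in> ?Y. x \<bullet> y) = N x"
  proof (rule antisym)
    show "(SUP y \<in> ?Y. x \<bullet> y) \<le> N x"
      using \<open>0 \<in> ?Y\<close> upper by (intro cSUP_least) blast+
    show "N x \<le> (SUP y \<in> ?Y. x \<bullet> y)"
    proof (rule dense_le)
      fix r assume "r < N x"
      show "r \<le> (SUP y \<in> ?Y. x \<bullet> y)"
      proof (cases "0 < r")
        case True
        then obtain y where "y \<in> ?Y" "r < x \<bullet> y" using lower \<open>r < N x\<close> by blast
        then show ?thesis using cSUP_upper[OF _ bdd, of y] by linarith
      next
        case False
        then show ?thesis using cSUP_upper[OF \<open>0 \<in> ?Y\<close> bdd] by simp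
      qed
    qed
  qed
  then show ?thesis by (simp add: local_norm_def dual_local_norm_eq[OF assms(1)])
qed

section \<open>The coupling on vectors with a given support\<close>

lemma capra_le_dual_norm_on:
  assumes "is_norm N"
  shows "capra N x y \<le> dual_norm_on N (supp x) y"
  using inner_le_dual_norm_on[OF assms supp_subset_coord_space, of x y]
    is_norm_pos[OF assms, of x] dual_norm_on_nonneg[OF assms, of "supp x" y]
  by (auto simp: capra_def field_simps)

text \<open>
  Density: a vector \<open>z\<close> of \<^term>\<open>coord_space K\<close> is the limit of \<open>z + t e\<close> for \<open>t \<rightarrow> 0\<close>,
  where \<open>e\<close> has support \<open>K\<close>. All but finitely many of these vectors have support exactly
  \<open>K\<close>, so the assumed bound applies to them and passes to the limit.
\<close>

lemma dual_norm_on_le_if_capra_le: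
  fixes N :: "real^'n \<Rightarrow> real"
  assumes "is_norm N" and capra_le: "\<And>x. supp x = K \<Longrightarrow> capra N x y \<le> m"
  shows "dual_norm_on N K y \<le> m"
proof -
  obtain e :: "real^'n" where e: "supp e = K" using ex_supp by blast
  \<comment> \<open>The coupling is odd in its first argument, so it is nonnegative at \<open>e\<close> or at \<open>- e\<close>.\<close>
  have "0 \<le> m"
  proof -
    have "supp (- e) = K" using e by (simp add: supp_def)
    then have "capra N (- e) y \<le> m" by (rule capra_le)
    moreover have "capra N (- e) y = - capra N e y"
      by (simp add: capra_def is_norm_minus[OF assms(1)])
    ultimately show ?thesis using capra_le[OF e] by linarith
  qed
  have "z \<bullet> y \<le> m" if z: "z \<in> coord_space K" "N z \<le> 1" for z
  proof (rule tendsto_le)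
    have "\<forall>\<^sub>F t in at (0::real). z $ j + t * e $ j \<noteq> 0" if "j \<in> K" for j
    proof (cases "z $ j = 0")
      case True
      then show ?thesis
        using that e eventually_neq_at_within[of 0 0 UNIV] by (auto simp: supp_def)
    next
      case False
      have "((\<lambda>t. z $ j + t * e $ j) \<longlongrightarrow> z $ j) (at 0)"
        by (auto intro!: tendsto_eq_intros)
      then show ?thesis using False by (rule tendsto_imp_eventually_ne)
    qed
    then have "\<forall>\<^sub>F t in at (0::real). \<forall>j \<in> K. z $ j + t * e $ j \<noteq> 0"
      by (intro eventually_ball_finite) auto
    then show "\<forall>\<^sub>F t in at 0. (z + t *\<^sub>R e) \<bullet> y \<le> m * (1 + \<bar>t\<bar> * N e)"
    proof eventually_elim
      case (elim t)
      let ?w = "z + t *\<^sub>R e"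
      have "supp ?w = K" using elim z(1) e by (auto simp: supp_def coord_space_def)
      then have "capra N ?w y \<le> m" by (rule capra_le)
      then have "?w \<bullet> y \<le> m * N ?w"
        using is_norm_pos[OF assms(1), of ?w]
        by (cases "?w = 0") (auto simp: capra_def field_simps is_norm_zero[OF assms(1)])
      also have "N ?w \<le> 1 + \<bar>t\<bar> * N e"
        using is_norm_triangle[OF assms(1), of z "t *\<^sub>R e"] z(2)
        by (simp add: is_norm_scale[OF assms(1)])
      then have "m * N ?w \<le> m * (1 + \<bar>t\<bar> * N e)"
        using \<open>0 \<le> m\<close> by (rule mult_left_mono)
      finally show ?case .
    qed
    show "((\<lambda>t. m * (1 + \<bar>t\<bar> * N e)) \<longlongrightarrow> m) (at 0)"
      by (auto intro!: tendsto_eq_intros)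
    show "((\<lambda>t. (z + t *\<^sub>R e) \<bullet> y) \<longlongrightarrow> z \<bullet> y) (at 0)"
      by (auto intro!: tendsto_eq_intros)
  qed simp
  then show ?thesis by (simp add: dual_norm_on_le_iff[OF assms(1)])
qed

lemma all_capra_le_iff:
  fixes N :: "real^'n \<Rightarrow> real" and r :: ereal
  assumes "is_norm N"
  shows "(\<forall>x. supp x = K \<longrightarrow> ereal (capra N x y) \<le> r) \<longleftrightarrow> ereal (dual_norm_on N K y) \<le> r"
proof
  assume le: "\<forall>x. supp x = K \<longrightarrow> ereal (capra N x y) \<le> r"
  show "ereal (dual_norm_on N K y) \<le> r"
  proof (cases r)
    case (real m)
    then show ?thesis using le dual_norm_on_le_if_capra_le[OF assms] by auto
  next
    case MInf
    then show ?thesis using le ex_supp[of K] by auto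
  qed simp
next
  assume le: "ereal (dual_norm_on N K y) \<le> r"
  show "\<forall>x. supp x = K \<longrightarrow> ereal (capra N x y) \<le> r"
  proof (intro allI impI)
    fix x :: "real^'n" assume "supp x = K"
    then have "ereal (capra N x y) \<le> ereal (dual_norm_on N K y)"
      using capra_le_dual_norm_on[OF assms, of x y] by simp
    then show "ereal (capra N x y) \<le> r" using le by (rule order_trans)
  qed
qed

section \<open>Subgradients and normal cones\<close>

text \<open>
  The conjugate is a supremum to which \<open>x\<close> itself contributes, so the defining equality
  amounts to an upper bound on every term of that supremum.
\<close>

lemma in_subdifferential_iff:
  "y \<in> subdifferential c f x \<longleftrightarrow>
     (\<forall>x'. ereal (c x' y) +\<^sub>l (- f x') \<le> ereal (c x y) +\<^sub>l (- f x))"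
proof -
  have "ereal (c x y) +\<^sub>l (- f x) \<le> conjugate c f y"
    unfolding conjugate_def by (rule SUP_upper) simp
  then have "y \<in> subdifferential c f x \<longleftrightarrow> conjugate c f y \<le> ereal (c x y) +\<^sub>l (- f x)"
    by (auto simp: subdifferential_def)
  then show ?thesis by (simp add: conjugate_def SUP_le_iff)
qed

text \<open>
  This is where the upper addition comes from: \<open>- a\<close> moves to the other side as \<open>a\<close>, and an
  infinite \<open>a\<close> that makes the left side \<open>-\<infinity>\<close> must make the right side \<open>\<infinity>\<close>, whatever \<open>b\<close> is.
\<close>

lemma low_add_le_iff:
  "ereal p +\<^sub>l (- a) \<le> ereal q +\<^sub>l (- b) \<longleftrightarrow> ereal p \<le> ereal q + (a +\<^sub>u (- b))"
  by (cases a; cases b) (auto simp: low_add_def upp_add_def)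

lemma in_subdifferential_supp_iff:
  fixes N :: "real^'n \<Rightarrow> real" and F :: "'n set \<Rightarrow> ereal"
  assumes "is_norm N"
  shows "y \<in> subdifferential (capra N) (F \<circ> supp) x \<longleftrightarrow>
    (\<forall>K. ereal (dual_norm_on N K y) \<le> ereal (capra N x y) + (F K +\<^sub>u (- F (supp x))))"
  unfolding in_subdifferential_iff low_add_le_iff all_capra_le_iff[OF assms, symmetric]
  by auto

text \<open>
  Membership in the normal cone says that the linear form \<open>\<langle>\<cdot>, y\<rangle>\<close> attains its maximum over
  the unit ball, which is the dual norm of \<open>y\<close>, at the normalised point \<open>x / N x\<close>, where its
  value is \<open>capra N x y\<close>.
\<close>

lemma in_normal_cone_local_ball_iff:
  fixes N :: "real^'n \<Rightarrow> real"
  assumes "is_norm N" "x \<noteq> 0"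
  shows "y \<in> normal_cone (local_ball N (supp x)) (x /\<^sub>R local_norm N (supp x) x) \<longleftrightarrow>
    dual_norm_on N (supp x) y = capra N x y"
proof -
  have ball: "local_ball N (supp x) = {z \<in> coord_space (supp x). N z \<le> 1}"
    by (auto simp: local_ball_def local_norm_eq[OF assms(1)])
  have "y \<in> normal_cone (local_ball N (supp x)) (x /\<^sub>R local_norm N (supp x) x) \<longleftrightarrow>
      dual_norm_on N (supp x) y \<le> capra N x y"
    unfolding normal_cone_def ball local_norm_eq[OF assms(1) supp_subset_coord_space]
      dual_norm_on_le_iff[OF assms(1)]
    using assms(2) by (auto simp: capra_def inner_diff_left divide_inverse_commute)
  then show ?thesis using capra_le_dual_norm_on[OF assms(1), of x y] by linarith
qed

theorem proposition12:
  fixes N :: "real^'n \<Rightarrow> real" and F :: "'n set \<Rightarrow> ereal" and x :: "real^'n"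
  assumes "is_norm N"
  shows
    "subdifferential (capra N) (F \<circ> supp) 0 =
       (\<Inter>K. scaled_dual_local_ball N K (F K +\<^sub>u (- F {})))
     \<and>
     (\<forall>L. x \<noteq> 0 \<and> L = supp x \<longrightarrow>
       (F L = -\<infinity> \<or> (\<forall>K. F K = \<infinity>) \<longrightarrow>
          subdifferential (capra N) (F \<circ> supp) x = UNIV) \<and>
       (F L = \<infinity> \<and> (\<exists>K. F K \<noteq> \<infinity>) \<longrightarrow>
          subdifferential (capra N) (F \<circ> supp) x = {}) \<and>
       (-\<infinity> < F L \<and> F L < \<infinity> \<longrightarrow>
          (\<forall>y. y \<in> subdifferential (capra N) (F \<circ> supp) x \<longleftrightarrow>
             y \<in> normal_cone (local_ball N L) (x /\<^sub>R local_norm N L x) \<and>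
             is_arg_max (\<lambda>K. ereal (dual_local_norm N K (coord_proj K y)) - F K)
               (\<lambda>K. K \<subseteq> UNIV) L)))"
proof -
  let ?D = "\<lambda>K y. dual_norm_on N K y"
  have D: "dual_local_norm N K (coord_proj K y) = ?D K y" for K y
    by (simp add: dual_local_norm_eq[OF assms] dual_norm_on_coord_proj)
  have at_zero: "subdifferential (capra N) (F \<circ> supp) 0 =
      (\<Inter>K. scaled_dual_local_ball N K (F K +\<^sub>u (- F {})))"
  proof -
    have "supp (0 :: real^'n) = {}" by (simp add: supp_eq_empty_iff)
    then show ?thesis
      by (auto simp: in_subdifferential_supp_iff[OF assms] scaled_dual_local_ball_def D
          capra_def zero_ereal_def[symmetric])
  qed
  have case_a: "subdifferential (capra N) (F \<circ> supp) x = UNIV"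
    if "F (supp x) = -\<infinity> \<or> (\<forall>K. F K = \<infinity>)"
    using that by (auto simp: in_subdifferential_supp_iff[OF assms] upp_add_def)
  have case_b: "subdifferential (capra N) (F \<circ> supp) x = {}"
    if FL: "F (supp x) = \<infinity>" and FK: "F K \<noteq> \<infinity>" for K
  proof -
    have "F K +\<^sub>u (- F (supp x)) = -\<infinity>" using FL FK by (simp add: upp_add_def)
    then have "y \<notin> subdifferential (capra N) (F \<circ> supp) x" for y
      unfolding in_subdifferential_supp_iff[OF assms]
      by (intro notI) (drule spec[of _ K], simp)
    then show ?thesis by blast
  qed
  have case_c: "y \<in> subdifferential (capra N) (F \<circ> supp) x \<longleftrightarrow>
      y \<in> normal_cone (local_ball N (supp x)) (x /\<^sub>R local_norm N (supp x) x) \<and>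
      is_arg_max (\<lambda>K. ereal (dual_local_norm N K (coord_proj K y)) - F K)
        (\<lambda>K. K \<subseteq> UNIV) (supp x)"
    if "x \<noteq> 0" and finite: "-\<infinity> < F (supp x)" "F (supp x) < \<infinity>" for y
  proof -
    obtain l where l: "F (supp x) = ereal l" using finite by (cases "F (supp x)") auto
    \<comment> \<open>With \<open>l\<close> finite the upper addition can be undone. Both sides hold if \<open>a = \<infinity>\<close> and
      fail if \<open>a = -\<infinity>\<close>.\<close>
    have shift: "ereal p \<le> ereal q + (a +\<^sub>u (- ereal l)) \<longleftrightarrow> ereal p - a \<le> ereal q - ereal l"
      for p q a
      by (cases a) (auto simp: upp_add_def)
    have "y \<in> subdifferential (capra N) (F \<circ> supp) x \<longleftrightarrow>
        (\<forall>K. ereal (?D K y) - F K \<le> ereal (capra N x y) - F (supp x))"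
      unfolding in_subdifferential_supp_iff[OF assms] l shift ..
    also have "\<dots> \<longleftrightarrow> ?D (supp x) y = capra N x y \<and>
        (\<forall>K. ereal (?D K y) - F K \<le> ereal (?D (supp x) y) - F (supp x))"
    proof -
      have "?D (supp x) y \<le> capra N x y"
        if "\<forall>K. ereal (?D K y) - F K \<le> ereal (capra N x y) - F (supp x)"
        using that[rule_format, of "supp x"] by (simp add: l)
      then show ?thesis using capra_le_dual_norm_on[OF assms, of x y] by force
    qed
    finally show ?thesis
      by (simp add: in_normal_cone_local_ball_iff[OF assms \<open>x \<noteq> 0\<close>] is_arg_max_def D not_less)
  qed
  show ?thesis using at_zero case_a case_b case_c by blast
qed

end
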